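(* Let $\mu_0\in[0,1/3]$ and $r_0\in[-1,1]$, and let $M_{1/3}$ be the copula $M_{1/3}(u,v)=\min\{u,\,v,\,(u-\tfrac23)^++(v-\tfrac13)^+\}$. For every symmetric copula $C_s$, the copula $3\mu_0\,M_{1/3}+(1-3\mu_0)\,C_s$ has $\mu_\infty$-value equal to $\mu_0$. Moreover, there exists a symmetric copula $C_s$ such that $$\rho\bigl(3\mu_0\,M_{1/3}+(1-3\mu_0)\,C_s\bigr)=r_0$$ if and only if $r_0\in[\,2\mu_0-1,\;1-4\mu_0\,]$.
   Context: A (bivariate) copula is a function $C:[0,1]^2\to[0,1]$ with $C(t,0)=C(0,t)=0$, $C(t,1)=C(1,t)=t$ for all $t\in[0,1]$, and $C(u',v')-C(u,v')-C(u',v)+C(u,v)\ge 0$ whenever $u\le u'$, $v\le v'$ in $[0,1]$. A copula $C$ is symmetric if $C(u,v)=C(v,u)$ for all $(u,v)\in[0,1]^2$. Notation: $(x)^+=\max\{0,x\}$; $\mu_\infty(C)=\sup_{(u,v)\in[0,1]^2}|C(u,v)-C(v,u)|$; $\rho(C)=12\int_{[0,1]^2}C(u,v)\,du\,dv-3$ (Spearman's $\rho$). *)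

theory Defs
  imports "HOL-Analysis.Analysis"
begin

text \<open>
  A copula is represented by a total function on the reals of which only the values on the unit
  square are relevant; all notions below depend on these values only.
\<close>

definition is_copula :: "(real \<Rightarrow> real \<Rightarrow> real) \<Rightarrow> bool" where
  "is_copula C \<longleftrightarrow>
     (\<forall>u\<in>{0..1}. \<forall>v\<in>{0..1}. C u v \<in> {0..1}) \<and>
     (\<forall>t\<in>{0..1}. C t 0 = 0 \<and> C 0 t = 0 \<and> C t 1 = t \<and> C 1 t = t) \<and>
     (\<forall>u\<in>{0..1}. \<forall>u'\<in>{0..1}. \<forall>v\<in>{0..1}. \<forall>v'\<in>{0..1}. u \<le> u' \<longrightarrow> v \<le> v' \<longrightarrow>
        C u' v' - C u v' - C u' v + C u v \<ge> 0)"

definition symmetric_copula :: "(real \<Rightarrow> real \<Rightarrow> real) \<Rightarrow> bool" where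
  "symmetric_copula C \<longleftrightarrow> is_copula C \<and> (\<forall>u\<in>{0..1}. \<forall>v\<in>{0..1}. C u v = C v u)"

definition pos_part :: "real \<Rightarrow> real" where
  "pos_part x = max 0 x"

definition mu_inf :: "(real \<Rightarrow> real \<Rightarrow> real) \<Rightarrow> real" where
  "mu_inf C = (SUP (u, v)\<in>{0..1} \<times> {0..1}. \<bar>C u v - C v u\<bar>)"

definition spearman_rho :: "(real \<Rightarrow> real \<Rightarrow> real) \<Rightarrow> real" where
  "spearman_rho C = 12 * integral ({0..1} \<times> {0..1}) (\<lambda>(u, v). C u v) - 3"

definition M_third :: "real \<Rightarrow> real \<Rightarrow> real" where
  "M_third u v = min u (min v (pos_part (u - 2/3) + pos_part (v - 1/3)))"

definition mixture :: "real \<Rightarrow> (real \<Rightarrow> real \<Rightarrow> real) \<Rightarrow> (real \<Rightarrow> real \<Rightarrow> real) \<Rightarrow> real \<Rightarrow> real \<Rightarrow> real" where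
  "mixture a A B u v = a * A u v + (1 - a) * B u v"

end

theory Submission
  imports Defs
begin

text \<open>
  Spearman's \<open>\<rho>\<close> is affine along mixtures of copulas, and \<open>\<rho>(M\<^bsub>1/3\<^esub>) = -1/3\<close>; hence the
  \<open>\<rho>\<close>-value of the mixture is \<open>-\<mu>\<^sub>0 + (1 - 3\<mu>\<^sub>0) \<rho>(C\<^sub>s)\<close>. The Frechet-Hoeffding bounds
  confine \<open>\<rho>(C\<^sub>s)\<close> to \<open>[-1, 1]\<close>; both bounds are symmetric copulas, so their mixtures attain every
  value in between. The symmetric part cancels in \<open>C(u,v) - C(v,u)\<close>, which leaves
  \<open>3\<mu>\<^sub>0\<close> times the maximal asymmetry \<open>1/3\<close> of \<open>M\<^bsub>1/3\<^esub>\<close>, attained at \<open>(1/3, 2/3)\<close>.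
\<close>

section \<open>Monotonicity, Lipschitz continuity and pointwise bounds of copulas\<close>

lemma is_copulaD:
  assumes "is_copula C"
  shows "\<And>t. t \<in> {0..1} \<Longrightarrow> C t 0 = 0" "\<And>t. t \<in> {0..1} \<Longrightarrow> C 0 t = 0"
    "\<And>t. t \<in> {0..1} \<Longrightarrow> C t 1 = t" "\<And>t. t \<in> {0..1} \<Longrightarrow> C 1 t = t"
    "\<And>u u' v v'. u \<in> {0..1} \<Longrightarrow> u' \<in> {0..1} \<Longrightarrow> v \<in> {0..1} \<Longrightarrow> v' \<in> {0..1} \<Longrightarrow>
       u \<le> u' \<Longrightarrow> v \<le> v' \<Longrightarrow> C u' v' - C u v' - C u' v + C u v \<ge> 0"
    "\<And>u v. u \<in> {0..1} \<Longrightarrow> v \<in> {0..1} \<Longrightarrow> C u v \<in> {0..1}"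
  using assms unfolding is_copula_def by blast+

text \<open>Both estimates are the rectangle inequality with one side on the boundary:
  \<open>[u, u'] x [0, v]\<close> gives monotonicity, \<open>[u, u'] x [v, 1]\<close> the Lipschitz
  bound.\<close>

lemma copula_mono_lipschitz_left:
  assumes C: "is_copula C" and "u \<in> {0..1}" "u' \<in> {0..1}" "v \<in> {0..1}" "u \<le> u'"
  shows "C u v \<le> C u' v" "C u' v - C u v \<le> u' - u"
proof -
  show "C u v \<le> C u' v"
    using is_copulaD(5)[OF C, of u u' 0 v] is_copulaD(1)[OF C] assms by simp
  show "C u' v - C u v \<le> u' - u"
    using is_copulaD(5)[OF C, of u u' v 1] is_copulaD(3)[OF C] assms by simp
qed

lemma copula_mono_lipschitz_right:
  assumes C: "is_copula C" and "u \<in> {0..1}" "v \<in> {0..1}" "v' \<in> {0..1}" "v \<le> v'"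
  shows "C u v \<le> C u v'" "C u v' - C u v \<le> v' - v"
proof -
  show "C u v \<le> C u v'"
    using is_copulaD(5)[OF C, of 0 u v v'] is_copulaD(2)[OF C] assms by simp
  show "C u v' - C u v \<le> v' - v"
    using is_copulaD(5)[OF C, of u 1 v v'] is_copulaD(4)[OF C] assms by simp
qed

lemma copula_lipschitz:
  assumes C: "is_copula C" and "u \<in> {0..1}" "u' \<in> {0..1}" "v \<in> {0..1}" "v' \<in> {0..1}"
  shows "\<bar>C u' v' - C u v\<bar> \<le> \<bar>u' - u\<bar> + \<bar>v' - v\<bar>"
proof -
  \<comment> \<open>One coordinate moves at a time, passing through the point
    \<open>(u, v')\<close>.\<close>
  have "\<bar>C u' v' - C u v'\<bar> \<le> \<bar>u' - u\<bar>"
    using copula_mono_lipschitz_left[OF C, of u u' v']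
      copula_mono_lipschitz_left[OF C, of u' u v'] assms
    by linarith
  moreover have "\<bar>C u v' - C u v\<bar> \<le> \<bar>v' - v\<bar>"
    using copula_mono_lipschitz_right[OF C, of u v v']
      copula_mono_lipschitz_right[OF C, of u v' v] assms
    by linarith
  ultimately show ?thesis by linarith
qed

text \<open>Comparison with the edges \<open>v = 1\<close> and \<open>u = 1\<close>: monotonicity up
  to them gives the upper bound, and the Lipschitz bound gives \<open>u + v - 1\<close> from
  below.\<close>

lemma copula_frechet_hoeffding:
  assumes C: "is_copula C" and "u \<in> {0..1}" "v \<in> {0..1}"
  shows "max 0 (u + v - 1) \<le> C u v" "C u v \<le> min u v"
  using copula_mono_lipschitz_right[OF C, of u v 1] copula_mono_lipschitz_left[OF C, of u 1 v]
    is_copulaD(3,4)[OF C] is_copulaD(6)[OF C, of u v] assms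
  by auto

lemma copula_continuous_on:
  assumes C: "is_copula C"
  shows "continuous_on ({0..1} \<times> {0..1}) (\<lambda>(u, v). C u v)"
proof -
  \<comment> \<open>The constant 2 arises because each of the two coordinate differences is at most
    \<open>dist p q\<close>.\<close>
  have "2-lipschitz_on ({0..1} \<times> {0..1}) (\<lambda>(u, v). C u v)"
  proof (rule lipschitz_onI)
    fix p q :: "real \<times> real"
    assume p: "p \<in> {0..1} \<times> {0..1}" and q: "q \<in> {0..1} \<times> {0..1}"
    obtain u v u' v' where [simp]: "p = (u', v')" "q = (u, v)"
      by (cases p, cases q)
    have "\<bar>C u' v' - C u v\<bar> \<le> \<bar>u' - u\<bar> + \<bar>v' - v\<bar>"
      using copula_lipschitz[OF C] p q by simp
    moreover have "\<bar>u' - u\<bar> \<le> dist p q" "\<bar>v' - v\<bar> \<le> dist p q"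
      using dist_fst_le[of p q] dist_snd_le[of p q] by (simp_all add: dist_real_def)
    ultimately show "dist (case p of (u, v) \<Rightarrow> C u v) (case q of (u, v) \<Rightarrow> C u v) \<le> 2 * dist p q"
      by (simp add: dist_real_def)
  qed simp
  then show ?thesis
    by (rule lipschitz_on_continuous_on)
qed

section \<open>Integration over the unit square\<close>

lemma unit_square_eq_cbox: "{0..1} \<times> {0..1} = cbox (0, 0) (1 :: real, 1 :: real)"
  by (simp add: cbox_Pair_eq)

lemma copula_integrable:
  assumes "is_copula C"
  shows "(\<lambda>(u, v). C u v) integrable_on ({0..1} \<times> {0..1})"
  using copula_continuous_on[OF assms] unfolding unit_square_eq_cbox
  by (rule integrable_continuous)

text \<open>Continuity of copulas makes Fubini's theorem applicable, so the values of rho below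
  reduce to one-variable antiderivatives.\<close>

lemma copula_integral_iterated:
  assumes C: "is_copula C"
    and inner: "\<And>u. u \<in> {0..1} \<Longrightarrow> (C u has_integral g u) {0..1}"
    and outer: "(g has_integral I) {0..1}"
  shows "integral ({0..1} \<times> {0..1}) (\<lambda>(u, v). C u v) = I"
proof -
  have "integral ({0..1} \<times> {0..1}) (\<lambda>(u, v). C u v) =
      integral {0..1} (\<lambda>u. integral {0..1} (C u))"
    using integral_prod_continuous[of 0 0 1 1 "\<lambda>(u, v). C u v"] copula_continuous_on[OF C]
    by (simp add: unit_square_eq_cbox)
  also have "\<dots> = integral {0..1} g"
    by (rule integral_cong) (use inner in auto)
  also have "\<dots> = I"
    using outer by (rule integral_unique)
  finally show ?thesis .
qed

section \<open>Mixtures of copulas\<close>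

lemma is_copula_mixture:
  assumes A: "is_copula A" and B: "is_copula B" and a: "a \<in> {0..1}"
  shows "is_copula (mixture a A B)"
  unfolding is_copula_def
proof (intro conjI ballI impI)
  fix u v :: real
  assume "u \<in> {0..1}" "v \<in> {0..1}"
  then have "A u v \<in> {0..1}" "B u v \<in> {0..1}"
    using is_copulaD(6)[OF A] is_copulaD(6)[OF B] by blast+
  then show "mixture a A B u v \<in> {0..1}"
    using a convex_bound_le[of "A u v" 1 "B u v" a "1 - a"] by (simp add: mixture_def)
next
  fix u u' v v' :: real
  assume *: "u \<in> {0..1}" "u' \<in> {0..1}" "v \<in> {0..1}" "v' \<in> {0..1}" "u \<le> u'" "v \<le> v'"
  have "a * (A u' v' - A u v' - A u' v + A u v)
      + (1 - a) * (B u' v' - B u v' - B u' v + B u v) \<ge> 0"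
    using a is_copulaD(5)[OF A *] is_copulaD(5)[OF B *] by simp
  then show "mixture a A B u' v' - mixture a A B u v' - mixture a A B u' v + mixture a A B u v \<ge> 0"
    by (simp add: mixture_def algebra_simps)
qed (simp_all add: mixture_def is_copulaD(1-4)[OF A] is_copulaD(1-4)[OF B] algebra_simps)

text \<open>The integral is linear, and the constant \<open>-3\<close> splits along with it because
  the weights add up to 1.\<close>

lemma spearman_rho_mixture:
  assumes "is_copula A" "is_copula B"
  shows "spearman_rho (mixture a A B) = a * spearman_rho A + (1 - a) * spearman_rho B"
proof -
  have "((\<lambda>p. a * (case p of (u, v) \<Rightarrow> A u v) + (1 - a) * (case p of (u, v) \<Rightarrow> B u v)) has_integral
      a * integral ({0..1} \<times> {0..1}) (\<lambda>(u, v). A u v)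
      + (1 - a) * integral ({0..1} \<times> {0..1}) (\<lambda>(u, v). B u v)) ({0..1} \<times> {0..1})"
    by (intro has_integral_add has_integral_mult_right integrable_integral copula_integrable assms)
  moreover have "(\<lambda>p. a * (case p of (u, v) \<Rightarrow> A u v) + (1 - a) * (case p of (u, v) \<Rightarrow> B u v))
      = (\<lambda>(u, v). mixture a A B u v)"
    by (auto simp: mixture_def)
  ultimately have "integral ({0..1} \<times> {0..1}) (\<lambda>(u, v). mixture a A B u v)
      = a * integral ({0..1} \<times> {0..1}) (\<lambda>(u, v). A u v)
      + (1 - a) * integral ({0..1} \<times> {0..1}) (\<lambda>(u, v). B u v)"
    using integral_unique by metis
  then show ?thesis
    by (simp add: spearman_rho_def algebra_simps)
qed

section \<open>Frechet-Hoeffding bounds and the range of Spearman's rho\<close>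

text \<open>Every section integrated below is a linear combination of truncations
  \<open>min a v\<close>, so this one formula yields all the inner integrals.\<close>

lemma has_integral_min_const:
  fixes a :: real
  assumes "a \<in> {0..1}"
  shows "((\<lambda>v. min a v) has_integral a - a\<^sup>2 / 2) {0..1}"
proof -
  have "((\<lambda>v. v) has_integral a\<^sup>2 / 2 - 0\<^sup>2 / 2) {0..a}"
    using assms
    by (intro fundamental_theorem_of_calculus)
      (auto intro!: derivative_eq_intros simp flip: has_real_derivative_iff_has_vector_derivative)
  then have 1: "((\<lambda>v. min a v) has_integral a\<^sup>2 / 2) {0..a}"
    by (subst has_integral_cong[where g = "\<lambda>v. v"]) auto
  have "((\<lambda>v. a) has_integral (1 - a) * a) {a..1}"
    using has_integral_const_real[of a a 1] assms by simp
  then have 2: "((\<lambda>v. min a v) has_integral (1 - a) * a) {a..1}"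
    by (subst has_integral_cong[where g = "\<lambda>v. a"]) auto
  show ?thesis
    using has_integral_combine[OF _ _ 1 2] assms
    by (simp add: algebra_simps power2_eq_square)
qed

lemma is_copula_min: "is_copula min"
  unfolding is_copula_def by (auto simp: min_def)

lemma is_copula_lower_bound: "is_copula (\<lambda>u v. max 0 (u + v - 1))"
  unfolding is_copula_def by (auto simp: max_def)

lemma spearman_rho_min: "spearman_rho min = 1"
proof -
  have "((\<lambda>u::real. u - u\<^sup>2 / 2) has_integral (1\<^sup>2 / 2 - 1 ^ 3 / 6) - (0\<^sup>2 / 2 - 0 ^ 3 / 6)) {0..1}"
    by (intro fundamental_theorem_of_calculus)
      (auto intro!: derivative_eq_intros simp flip: has_real_derivative_iff_has_vector_derivative)
  then have "integral ({0..1} \<times> {0..1}) (\<lambda>(u::real, v). min u v) = 1 / 3"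
    by (intro copula_integral_iterated[OF is_copula_min has_integral_min_const]) simp_all
  then show ?thesis by (simp add: spearman_rho_def)
qed

lemma spearman_rho_lower_bound: "spearman_rho (\<lambda>u v. max 0 (u + v - 1)) = -1"
proof -
  have inner: "((\<lambda>v. max 0 (u + v - 1)) has_integral u\<^sup>2 / 2) {0..1}" if "u \<in> {0..1}" for u :: real
  proof -
    \<comment> \<open>For \<open>v\<close> in the unit interval \<open>min 1 v = v\<close>, and
      \<open>v - min (1 - u) v\<close> is the positive part of \<open>u + v - 1\<close>.\<close>
    have "((\<lambda>v. min 1 v - min (1 - u) v) has_integral
        (1 - 1\<^sup>2 / 2) - ((1 - u) - (1 - u)\<^sup>2 / 2)) {0..1}"
      using that by (intro has_integral_diff has_integral_min_const) auto
    moreover have "(1 - 1\<^sup>2 / 2) - ((1 - u) - (1 - u)\<^sup>2 / 2) = u\<^sup>2 / 2"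
      by (simp add: power2_eq_square field_simps)
    ultimately have "((\<lambda>v. min 1 v - min (1 - u) v) has_integral u\<^sup>2 / 2) {0..1}"
      by (simp only:)
    then show ?thesis
      by (rule has_integral_eq[rotated]) auto
  qed
  have "((\<lambda>u::real. u\<^sup>2 / 2) has_integral 1 ^ 3 / 6 - 0 ^ 3 / 6) {0..1}"
    by (intro fundamental_theorem_of_calculus)
      (auto intro!: derivative_eq_intros simp flip: has_real_derivative_iff_has_vector_derivative)
  then have "integral ({0..1} \<times> {0..1}) (\<lambda>(u::real, v). max 0 (u + v - 1)) = 1 / 6"
    by (intro copula_integral_iterated[OF is_copula_lower_bound inner]) simp_all
  then show ?thesis by (simp add: spearman_rho_def)
qed

lemma spearman_rho_mono:
  assumes "is_copula A" "is_copula B"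
    and "\<And>u v. u \<in> {0..1} \<Longrightarrow> v \<in> {0..1} \<Longrightarrow> A u v \<le> B u v"
  shows "spearman_rho A \<le> spearman_rho B"
  unfolding spearman_rho_def
  using integral_le[OF copula_integrable[OF assms(1)] copula_integrable[OF assms(2)]] assms(3)
  by fastforce

lemma spearman_rho_bounds:
  assumes "is_copula C"
  shows "spearman_rho C \<in> {-1..1}"
  using spearman_rho_mono[OF is_copula_lower_bound assms] spearman_rho_mono[OF assms is_copula_min]
    copula_frechet_hoeffding[OF assms] spearman_rho_min spearman_rho_lower_bound
  by simp

section \<open>The copula \<open>M_third\<close>\<close>

lemma M_third_0_1:
  assumes "t \<in> {0..1}"
  shows "M_third t 0 = 0" "M_third 0 t = 0" "M_third t 1 = t" "M_third 1 t = t"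
  using assms by (auto simp: M_third_def pos_part_def min_def max_def)

text \<open>
  \<open>M\<^bsub>1/3\<^esub>\<close> is carried by the graph of the interval exchange \<open>u \<mapsto> u + 1/3 mod 1\<close>;
  the summands are the masses on its two segments.
\<close>

lemma M_third_eq_add_min:
  assumes "u \<in> {0..1}" "v \<in> {0..1}"
  shows "M_third u v = min (min u (2/3)) (max 0 (v - 1/3)) + min (max 0 (u - 2/3)) (min v (1/3))"
  using assms unfolding M_third_def pos_part_def min_def max_def by auto

text \<open>Applied to each summand of \<open>M_third_eq_add_min\<close>, which is the minimum of a
  nondecreasing function of \<open>u\<close> and one of \<open>v\<close>.\<close>

lemma min_two_increasing:
  fixes x x' y y' :: real
  assumes "x \<le> x'" "y \<le> y'"
  shows "min x' y' - min x y' - min x' y + min x y \<ge> 0"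
  using assms by linarith

lemma is_copula_M_third: "is_copula M_third"
  unfolding is_copula_def
proof (intro conjI ballI impI)
  fix u u' v v' :: real
  assume *: "u \<in> {0..1}" "u' \<in> {0..1}" "v \<in> {0..1}" "v' \<in> {0..1}" "u \<le> u'" "v \<le> v'"
  have "min u (2/3) \<le> min u' (2/3)" "max 0 (v - 1/3) \<le> max 0 (v' - 1/3)"
    "max 0 (u - 2/3) \<le> max 0 (u' - 2/3)" "min v (1/3) \<le> min v' (1/3)"
    using * by linarith+
  from min_two_increasing[OF this(1,2)] min_two_increasing[OF this(3,4)]
  show "M_third u' v' - M_third u v' - M_third u' v + M_third u v \<ge> 0"
    using * by (simp add: M_third_eq_add_min)
qed (auto simp: M_third_0_1, auto simp: M_third_def pos_part_def)

lemma M_third_asymmetry_le: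
  assumes "u \<in> {0..1}" "v \<in> {0..1}"
  shows "\<bar>M_third u v - M_third v u\<bar> \<le> 1/3"
  using assms unfolding M_third_def pos_part_def min_def max_def by (auto simp: abs_if)

text \<open>The interval exchange sends \<open>[0, u]\<close> onto an interval starting at 1/3 and,
  once \<open>u > 2/3\<close>, also one starting at 0. The terms measure how much of these lies in
  \<open>[0, v]\<close>: for \<open>a <= b\<close>, \<open>min b v - min a v\<close> is the length
  of \<open>[a, b]\<close> below \<open>v\<close>.\<close>

lemma M_third_eq_min_const:
  assumes "u \<in> {0..1}" "v \<in> {0..1}"
  shows "M_third u v =
    min (min u (2/3) + 1/3) v - min (1/3) v + min (max 0 (u - 2/3)) v"
  using assms unfolding M_third_def pos_part_def min_def max_def by auto

lemma spearman_rho_M_third: "spearman_rho M_third = -1/3"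
proof -
  \<comment> \<open>\<open>G a\<close> is the integral of \<open>min a v\<close> over the unit
    interval.\<close>
  define G :: "real \<Rightarrow> real" where "G a = a - a\<^sup>2 / 2" for a
  define g where "g u = G (min u (2/3) + 1/3) - G (1/3) + G (max 0 (u - 2/3))" for u
  have inner: "(M_third u has_integral g u) {0..1}" if "u \<in> {0..1}" for u
  proof -
    have "((\<lambda>v. min (min u (2/3) + 1/3) v - min (1/3) v + min (max 0 (u - 2/3)) v)
        has_integral g u) {0..1}"
      unfolding g_def G_def using that
      by (intro has_integral_add has_integral_diff has_integral_min_const) auto
    then show ?thesis
      by (rule has_integral_eq[rotated]) (use that in \<open>simp add: M_third_eq_min_const\<close>)
  qed
  \<comment> \<open>The integrand is \<open>G (u + 1/3) - G (1/3)\<close>, to which \<open>g\<close>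
    reduces for \<open>u\<close> up to 2/3, as \<open>G 0 = 0\<close>.\<close>
  have "((\<lambda>u::real. 2 / 3 * u - u\<^sup>2 / 2) has_integral
      ((2/3)\<^sup>2 / 3 - (2/3) ^ 3 / 6) - (0\<^sup>2 / 3 - 0 ^ 3 / 6)) {0..2/3}"
    by (intro fundamental_theorem_of_calculus)
      (auto intro!: derivative_eq_intros simp flip: has_real_derivative_iff_has_vector_derivative)
  then have "((\<lambda>u::real. 2 / 3 * u - u\<^sup>2 / 2) has_integral 8/81) {0..2/3}"
    by (simp add: power2_eq_square power3_eq_cube)
  then have 1: "(g has_integral 8/81) {0..2/3}"
    by (rule has_integral_eq[rotated])
      (simp add: g_def G_def min_absorb1 max_absorb1 power2_eq_square field_simps)
  \<comment> \<open>Beyond 2/3 the first argument of \<open>G\<close> stays at 1, and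
    \<open>g u\<close> becomes \<open>G 1 - G (1/3) + G (u - 2/3)\<close>.\<close>
  have "((\<lambda>u::real. 5 / 3 * u - u\<^sup>2 / 2 - 2 / 3) has_integral
      (5 * 1\<^sup>2 / 6 - 1 ^ 3 / 6 - 2/3 * 1) - (5 * (2/3)\<^sup>2 / 6 - (2/3) ^ 3 / 6 - 2/3 * (2/3))) {2/3..1}"
    by (intro fundamental_theorem_of_calculus)
      (auto intro!: derivative_eq_intros simp flip: has_real_derivative_iff_has_vector_derivative)
  then have "((\<lambda>u::real. 5 / 3 * u - u\<^sup>2 / 2 - 2 / 3) has_integral 10/81) {2/3..1}"
    by (simp add: power2_eq_square power3_eq_cube)
  moreover have "5 / 3 * u - u\<^sup>2 / 2 - 2 / 3 = g u" if "u \<in> {2/3..1}" for u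
    using that
    by (simp add: g_def G_def min_absorb2 max_absorb2 power2_eq_square field_simps)
  ultimately have 2: "(g has_integral 10/81) {2/3..1}"
    using has_integral_eq by (metis (no_types, lifting))
  have "(g has_integral 2/9) {0..1}"
    using has_integral_combine[OF _ _ 1 2] by simp
  then have "integral ({0..1} \<times> {0..1}) (\<lambda>(u, v). M_third u v) = 2/9"
    by (intro copula_integral_iterated[OF is_copula_M_third inner])
  then show ?thesis by (simp add: spearman_rho_def)
qed

section \<open>Asymmetry and attainable rho-values of the mixture\<close>

lemma mu_inf_mixture_M_third:
  assumes "\<mu> \<ge> 0" "symmetric_copula C"
  shows "mu_inf (mixture (3 * \<mu>) M_third C) = \<mu>"
proof -
  let ?X = "mixture (3 * \<mu>) M_third C"
  have diff: "\<bar>?X u v - ?X v u\<bar> = 3 * \<mu> * \<bar>M_third u v - M_third v u\<bar>"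
    if "u \<in> {0..1}" "v \<in> {0..1}" for u v
  proof -
    have "C u v = C v u"
      using assms(2) that by (simp add: symmetric_copula_def)
    then have "?X u v - ?X v u = 3 * \<mu> * (M_third u v - M_third v u)"
      by (simp add: mixture_def algebra_simps)
    then show ?thesis
      using assms(1) by (simp add: abs_mult)
  qed
  show ?thesis
    unfolding mu_inf_def
  proof (rule cSup_eq_maximum)
    \<comment> \<open>At this point and its reflection \<open>M_third\<close> takes the values 1/3
      and 0.\<close>
    have "\<bar>?X (1/3) (2/3) - ?X (2/3) (1/3)\<bar> = \<mu>"
      by (subst diff) (auto simp: M_third_def pos_part_def)
    then show "\<mu> \<in> (\<lambda>(u, v). \<bar>?X u v - ?X v u\<bar>) ` ({0..1} \<times> {0..1})"
      by (intro image_eqI[where x = "(1/3, 2/3)"]) auto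
  next
    fix x assume "x \<in> (\<lambda>(u, v). \<bar>?X u v - ?X v u\<bar>) ` ({0..1} \<times> {0..1})"
    then obtain u v where uv: "u \<in> {0..1}" "v \<in> {0..1}" and x: "x = \<bar>?X u v - ?X v u\<bar>"
      by auto
    show "x \<le> \<mu>"
      using mult_left_mono[OF M_third_asymmetry_le[OF uv], of "3 * \<mu>"] diff[OF uv] assms(1) x
      by simp
  qed
qed

lemma exists_symmetric_copula_spearman_rho:
  assumes "s \<in> {-1..1}"
  shows "\<exists>C. symmetric_copula C \<and> spearman_rho C = s"
proof (intro exI conjI)
  \<comment> \<open>The weight solves \<open>a * 1 + (1 - a) * (-1) = s\<close>.\<close>
  let ?C = "mixture ((1 + s) / 2) min (\<lambda>u v. max 0 (u + v - 1))"
  have "is_copula ?C"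
    using assms by (intro is_copula_mixture is_copula_min is_copula_lower_bound) auto
  then show "symmetric_copula ?C"
    by (simp add: symmetric_copula_def mixture_def min.commute add.commute)
  show "spearman_rho ?C = s"
    unfolding spearman_rho_mixture[OF is_copula_min is_copula_lower_bound]
      spearman_rho_min spearman_rho_lower_bound
    by (simp add: field_simps)
qed

theorem mainTheorem4:
  fixes \<mu>\<^sub>0 r\<^sub>0 :: real
  assumes "\<mu>\<^sub>0 \<in> {0..1/3}" and "r\<^sub>0 \<in> {-1..1}"
  shows "is_copula M_third \<and>
    (\<forall>C. symmetric_copula C \<longrightarrow>
       is_copula (mixture (3 * \<mu>\<^sub>0) M_third C) \<and> mu_inf (mixture (3 * \<mu>\<^sub>0) M_third C) = \<mu>\<^sub>0) \<and>
    ((\<exists>C. symmetric_copula C \<and> spearman_rho (mixture (3 * \<mu>\<^sub>0) M_third C) = r\<^sub>0)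
       \<longleftrightarrow> r\<^sub>0 \<in> {2 * \<mu>\<^sub>0 - 1..1 - 4 * \<mu>\<^sub>0})"
proof (intro conjI allI impI)
  show "is_copula M_third" by (rule is_copula_M_third)
next
  fix C assume "symmetric_copula C"
  then show "is_copula (mixture (3 * \<mu>\<^sub>0) M_third C)"
    using assms(1) by (intro is_copula_mixture is_copula_M_third) (auto simp: symmetric_copula_def)
next
  fix C assume "symmetric_copula C"
  then show "mu_inf (mixture (3 * \<mu>\<^sub>0) M_third C) = \<mu>\<^sub>0"
    using assms(1) by (intro mu_inf_mixture_M_third) auto
next
  have rho: "spearman_rho (mixture (3 * \<mu>\<^sub>0) M_third C) = (1 - 3 * \<mu>\<^sub>0) * spearman_rho C - \<mu>\<^sub>0"
    if "symmetric_copula C" for C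
    using that spearman_rho_mixture[OF is_copula_M_third]
    by (simp add: spearman_rho_M_third symmetric_copula_def)
  show "(\<exists>C. symmetric_copula C \<and> spearman_rho (mixture (3 * \<mu>\<^sub>0) M_third C) = r\<^sub>0)
       \<longleftrightarrow> r\<^sub>0 \<in> {2 * \<mu>\<^sub>0 - 1..1 - 4 * \<mu>\<^sub>0}"
  proof
    assume "\<exists>C. symmetric_copula C \<and> spearman_rho (mixture (3 * \<mu>\<^sub>0) M_third C) = r\<^sub>0"
    then obtain C where C: "symmetric_copula C"
      and r: "r\<^sub>0 = (1 - 3 * \<mu>\<^sub>0) * spearman_rho C - \<mu>\<^sub>0"
      using rho by auto
    have "spearman_rho C \<in> {-1..1}"
      using C by (intro spearman_rho_bounds) (simp add: symmetric_copula_def)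
    \<comment> \<open>Since \<open>1 - 3 * \<mu>\<^sub>0\<close> is nonnegative, the affine map
      preserves order and sends the extreme values -1 and 1 of rho to the two endpoints.\<close>
    then show "r\<^sub>0 \<in> {2 * \<mu>\<^sub>0 - 1..1 - 4 * \<mu>\<^sub>0}"
      using assms(1) mult_left_mono[of "-1" "spearman_rho C" "1 - 3 * \<mu>\<^sub>0"]
        mult_left_mono[of "spearman_rho C" 1 "1 - 3 * \<mu>\<^sub>0"] r
      by auto
  next
    assume r: "r\<^sub>0 \<in> {2 * \<mu>\<^sub>0 - 1..1 - 4 * \<mu>\<^sub>0}"
    \<comment> \<open>At \<open>\<mu>\<^sub>0 = 1/3\<close> the quotient is \<open>0\<close>, and \<open>r\<^sub>0 = -1/3\<close> is forced.\<close>
    define s where "s = (r\<^sub>0 + \<mu>\<^sub>0) / (1 - 3 * \<mu>\<^sub>0)"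
    have s: "(1 - 3 * \<mu>\<^sub>0) * s - \<mu>\<^sub>0 = r\<^sub>0"
      using r by (cases "1 - 3 * \<mu>\<^sub>0 = 0") (auto simp: s_def)
    have "s \<in> {-1..1}"
    proof (cases "1 - 3 * \<mu>\<^sub>0 = 0")
      case False
      then have "1 - 3 * \<mu>\<^sub>0 > 0" using assms(1) by simp
      then show ?thesis using r by (simp add: s_def field_simps)
    qed (simp add: s_def)
    then obtain C where "symmetric_copula C" "spearman_rho C = s"
      using exists_symmetric_copula_spearman_rho by blast
    then show "\<exists>C. symmetric_copula C \<and> spearman_rho (mixture (3 * \<mu>\<^sub>0) M_third C) = r\<^sub>0"
      using rho s by auto
  qed
qed

end
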